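(* Let $n,m\ge 0$ be integers. If $n\ge m-1$, then $$H_n(x;c)\,H_m(x)=\sum_{k=0}^{\min(m,\lfloor (n+m)/2\rfloor)}\binom{n-1+c}{k}\binom{m}{k}\,k!\;H_{n+m-2k}(x;c).$$
   Context: $c$ is an indeterminate and $\binom{a}{k}=a(a-1)\cdots(a-k+1)/k!$ for arbitrary $a$. The associated Hermite polynomials are defined by $H_0(x;c)=1$, $H_m(x;c)=0$ for $m<0$, and $H_{n+1}(x;c)=xH_n(x;c)-(n-1+c)H_{n-1}(x;c)$ for $n\ge0$. The usual Hermite polynomials $H_m(x)$ are defined by $H_0(x)=1$, $H_m(x)=0$ for $m<0$, and $H_{n+1}(x)=xH_n(x)-nH_{n-1}(x)$ for $n\ge 0$. *)

theory Defs
  imports "HOL-Computational_Algebra.Polynomial"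
begin

text \<open>
  Both families are indexed by the integers, as the recurrences at \<open>n = 0\<close> refer to index \<open>-1\<close>.
  They are polynomials in \<open>x = [:0, 1:]\<close>; the recurrences are shifted by one, so the coefficient
  \<open>n - 1 + c\<close> (resp. \<open>n\<close>) of the step from \<open>n\<close> to \<open>n + 1\<close> appears as \<open>n - 2 + c\<close> (resp. \<open>n - 1\<close>).
\<close>

function assoc_hermite :: "'a::comm_ring_1 \<Rightarrow> int \<Rightarrow> 'a poly" where
  "assoc_hermite c n =
     (if n < 0 then 0
      else if n = 0 then 1
      else [:0, 1:] * assoc_hermite c (n - 1)
           - smult (of_int (n - 2) + c) (assoc_hermite c (n - 2)))"
  by auto
termination by (relation "measure (\<lambda>(c, n). nat (n + 1))") auto

function hermite :: "int \<Rightarrow> 'a::comm_ring_1 poly" where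
  "hermite n =
     (if n < 0 then 0
      else if n = 0 then 1
      else [:0, 1:] * hermite (n - 1) - smult (of_int (n - 1)) (hermite (n - 2)))"
  by auto
termination by (relation "measure (\<lambda>n. nat (n + 1))") auto

declare assoc_hermite.simps [simp del] hermite.simps [simp del]

lemma assoc_hermite_neg: "m < 0 \<Longrightarrow> assoc_hermite c m = 0"
  and assoc_hermite_0: "assoc_hermite c 0 = 1"
  and assoc_hermite_rec: "n \<ge> 0 \<Longrightarrow> assoc_hermite c (n + 1) =
        [:0, 1:] * assoc_hermite c n - smult (of_int (n - 1) + c) (assoc_hermite c (n - 1))"
  by (subst assoc_hermite.simps, simp)+

lemma hermite_neg: "m < 0 \<Longrightarrow> hermite m = 0"
  and hermite_0: "hermite 0 = 1"
  and hermite_rec: "n \<ge> 0 \<Longrightarrow> hermite (n + 1) =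
        [:0, 1:] * hermite n - smult (of_int n) (hermite (n - 1))"
  by (subst hermite.simps, simp)+

text \<open>
  The indeterminate \<open>c\<close> of the coefficient ring \<open>'k[c]\<close>, so that \<open>assoc_hermite indet_c n\<close> lies in
  \<open>'k[c][x]\<close>.
\<close>

definition indet_c :: "'k::field_char_0 poly" where
  "indet_c = [:0, 1:]"

text \<open>
  \<open>a (a - 1) \<dots> (a - k + 1) / k!\<close> for \<open>a\<close> in \<open>'k[c]\<close>. The library's \<open>gchoose\<close> is constrained to
  fields of characteristic 0, hence not available in \<open>'k[c]\<close>.
\<close>

definition poly_gbinomial :: "'k::field_char_0 poly \<Rightarrow> nat \<Rightarrow> 'k poly" where
  "poly_gbinomial a k = smult (1 / fact k) (\<Prod>i<k. a - of_nat i)"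

lemma poly_poly_gbinomial: "poly (poly_gbinomial a k) t = poly a t gchoose k"
  by (simp add: poly_gbinomial_def gbinomial_prod_rev poly_prod atLeast0LessThan)

end

(*
  Induct on m through hermite (m + 1) = x hermite m - m hermite (m - 1): multiply the expansion for m
  by x, apply x H_j(x;c) = H_{j+1}(x;c) + (j - 1 + c) H_{j-1}(x;c) to each term and compare
  coefficients by Pascal's rule. The hypothesis n >= m - 1 keeps every index j nonnegative where this
  recurrence is applied; it fails at j = -1.
*)

theory Submission imports Defs begin

lemma smult_sum_right: "smult a (\<Sum>i\<in>A. f i) = (\<Sum>i\<in>A. smult a (f i))"
  by (induction A rule: infinite_finite_induct) (simp_all add: smult_add_right)

text \<open>Absorption with the difference taken in the ring, so that it can cancel against the
  linear factors of the recurrence; \<open>k \<le> m\<close> rules out truncated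
  subtraction.\<close>

lemma diff_mult_of_nat_binomial:
  assumes "k \<le> m"
  shows "(of_nat m - of_nat k) * of_nat (m choose k) =
    of_nat m * (of_nat (m - 1 choose k) :: 'a::comm_ring_1)"
proof -
  have "(m - k) * (m choose k) = m * (m - 1 choose k)"
    by (rule binomial_absorb_comp)
  then have "of_nat (m - k) * of_nat (m choose k) = (of_nat m * of_nat (m - 1 choose k) :: 'a)"
    by (metis of_nat_mult)
  with assms show ?thesis
    by (simp add: of_nat_diff)
qed

lemma assoc_hermite_times_x:
  assumes "n \<ge> 0"
  shows "[:0, 1:] * assoc_hermite c n =
    assoc_hermite c (n + 1) + smult (of_int (n - 1) + c) (assoc_hermite c (n - 1))"
  using assoc_hermite_rec[OF assms, of c] by simp

text \<open>Writing binomial times factorial as a falling product avoids division, so any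
  commutative ring will do. The sum runs to \<open>m\<close>; an index can only drop to -1, where
  the term is 0.\<close>

lemma assoc_hermite_mult_hermite:
  fixes c :: "'a::comm_ring_1"
  assumes "m \<le> n + 1"
  shows "assoc_hermite c (int n) * hermite (int m) =
    (\<Sum>k\<le>m. smult ((\<Prod>i<k. of_nat n - 1 + c - of_nat i) * of_nat (m choose k))
              (assoc_hermite c (int n + int m - 2 * int k)))"
  using assms
\<comment> \<open>The Hermite recurrence reaches back two indices, hence strong induction.\<close>
proof (induction m rule: less_induct)
  case (less m)
  define P where "P k = (\<Prod>i<k. of_nat n - 1 + c - of_nat i)" for k
  have P_Suc: "P (Suc k) = P k * (of_nat n - 1 + c - of_nat k)" for k
    by (simp add: P_def)
  show ?case
  proof (cases m)
    case 0
    then show ?thesis by (simp add: hermite_0)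
  next
    case (Suc l)
    then have ln: "l \<le> n" using less.prems by simp
    \<comment> \<open>\<open>F k\<close> belongs to the target \<open>m = Suc l\<close>: raising the
      index of the \<open>k\<close>-th term for \<open>l\<close> gives \<open>F k\<close>, lowering
      it gives \<open>F (Suc k)\<close>.\<close>
    define F where "F k = assoc_hermite c (int n + int l + 1 - 2 * int k)" for k
    have IH: "assoc_hermite c (int n) * hermite (int l) =
      (\<Sum>k\<le>l. smult (P k * of_nat (l choose k)) (assoc_hermite c (int n + int l - 2 * int k)))"
      using less.IH[of l] Suc ln by (simp add: P_def)
    have x_part: "[:0, 1:] * (assoc_hermite c (int n) * hermite (int l)) =
      (\<Sum>k\<le>l. smult (P k * of_nat (l choose k)) (F k)) +
      (\<Sum>k\<le>l. smult (P k * of_nat (l choose k) * (of_nat n + of_nat l - 2 * of_nat k - 1 + c)) (F (Suc k)))"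
    proof -
      have "[:0, 1:] * smult (P k * of_nat (l choose k)) (assoc_hermite c (int n + int l - 2 * int k)) =
          smult (P k * of_nat (l choose k)) (F k) +
          smult (P k * of_nat (l choose k) * (of_nat n + of_nat l - 2 * of_nat k - 1 + c)) (F (Suc k))"
        if "k \<le> l" for k
      proof -
        \<comment> \<open>The smallest index, at \<open>k = l\<close>, is \<open>n - l\<close>; this
          is where the bound on \<open>m\<close> enters.\<close>
        have "0 \<le> int n + int l - 2 * int k" using that ln by simp
        from assoc_hermite_times_x[OF this, of c] show ?thesis
          by (simp only: mult_smult_right) (simp add: F_def smult_add_right algebra_simps)
      qed
      then show ?thesis
        unfolding IH sum_distrib_left by (simp add: sum.distrib)
    qed
    have low_part: "smult (of_nat l) (assoc_hermite c (int n) * hermite (int l - 1)) =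
      (\<Sum>k\<le>l. smult (of_nat l * P k * of_nat (l - 1 choose k)) (F (Suc k)))"
    proof (cases l)
      case 0
      then show ?thesis by simp
    next
      case (Suc j)
      then have "assoc_hermite c (int n) * hermite (int j) =
        (\<Sum>k\<le>j. smult (P k * of_nat (j choose k)) (assoc_hermite c (int n + int j - 2 * int k)))"
        using less.IH[of j] \<open>m = Suc l\<close> ln by (simp add: P_def)
      \<comment> \<open>The new term \<open>k = l\<close> vanishes because \<open>j choose l\<close>
        is 0 for \<open>l = Suc j\<close>.\<close>
      also have "\<dots> = (\<Sum>k\<le>l. smult (P k * of_nat (j choose k)) (F (Suc k)))"
        using Suc by (simp add: F_def algebra_simps binomial_eq_0)
      finally show ?thesis
        using Suc by (simp add: smult_sum_right smult_add_right mult.assoc)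
    qed
    \<comment> \<open>By absorption the last term is \<open>P k * (l - k) * (l choose k)\<close>.
      Subtracting it leaves the factor \<open>n - 1 + c - k\<close>, which turns \<open>P k\<close>
      into \<open>P (Suc k)\<close>; Pascal's rule does the rest.\<close>
    have coeff: "P (Suc k) * of_nat (Suc l choose Suc k) = P (Suc k) * of_nat (l choose Suc k) +
        P k * of_nat (l choose k) * (of_nat n + of_nat l - 2 * of_nat k - 1 + c) -
        of_nat l * P k * of_nat (l - 1 choose k)" if "k \<le> l" for k
    proof -
      have "of_nat l * P k * of_nat (l - 1 choose k) =
          P k * ((of_nat l - of_nat k) * of_nat (l choose k))"
        unfolding diff_mult_of_nat_binomial[OF that] by (simp only: mult_ac)
      then show ?thesis
        by (simp add: P_Suc algebra_simps)
    qed
    have sum_coeff: "(\<Sum>k\<le>l. smult (P (Suc k) * of_nat (Suc l choose Suc k)) (F (Suc k))) =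
        (\<Sum>k\<le>l. smult (P (Suc k) * of_nat (l choose Suc k)) (F (Suc k))) +
        (\<Sum>k\<le>l. smult (P k * of_nat (l choose k) * (of_nat n + of_nat l - 2 * of_nat k - 1 + c)) (F (Suc k))) -
        (\<Sum>k\<le>l. smult (of_nat l * P k * of_nat (l - 1 choose k)) (F (Suc k)))"
      unfolding sum.distrib[symmetric] sum_subtractf[symmetric]
      by (intro sum.cong refl) (simp only: coeff atMost_iff smult_add_left smult_diff_left)
    \<comment> \<open>Appending the zero term \<open>k = Suc l\<close> and splitting off
      \<open>k = 0\<close> aligns this sum with the others.\<close>
    have shift: "(\<Sum>k\<le>l. smult (P k * of_nat (l choose k)) (F k)) =
        F 0 + (\<Sum>k\<le>l. smult (P (Suc k) * of_nat (l choose Suc k)) (F (Suc k)))"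
    proof -
      have "(\<Sum>k\<le>l. smult (P k * of_nat (l choose k)) (F k)) =
          (\<Sum>k\<le>Suc l. smult (P k * of_nat (l choose k)) (F k))"
        by (simp add: binomial_eq_0)
      also have "\<dots> = F 0 + (\<Sum>k\<le>l. smult (P (Suc k) * of_nat (l choose Suc k)) (F (Suc k)))"
        by (subst sum.atMost_Suc_shift) (simp add: P_def)
      finally show ?thesis .
    qed
    have "hermite (int m) = [:0, 1:] * hermite (int l) - smult (of_nat l) (hermite (int l - 1) :: 'a poly)"
      using hermite_rec[of "int l"] Suc by (simp add: add.commute)
    then have "assoc_hermite c (int n) * hermite (int m) =
        [:0, 1:] * (assoc_hermite c (int n) * hermite (int l)) -
        smult (of_nat l) (assoc_hermite c (int n) * hermite (int l - 1))"
      by (simp only: right_diff_distrib mult_smult_right mult.left_commute)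
    also have "\<dots> = F 0 + (\<Sum>k\<le>l. smult (P (Suc k) * of_nat (Suc l choose Suc k)) (F (Suc k)))"
      unfolding x_part low_part shift sum_coeff by (simp only: add.assoc add_diff_eq)
    also have "\<dots> = (\<Sum>k\<le>Suc l. smult (P k * of_nat (Suc l choose k)) (F k))"
      by (subst sum.atMost_Suc_shift) (simp add: P_def)
    finally show ?thesis
      using Suc by (simp only: P_def F_def of_nat_Suc add.assoc add.commute[of 1])
  qed
qed

lemma poly_gbinomial_mult_fact:
  "poly_gbinomial a k * fact k = (\<Prod>i<k. a - of_nat i)"
proof -
  have "(fact k :: 'a poly) = [:fact k:]"
    by (metis of_nat_fact of_nat_poly)
  then show ?thesis
    by (simp add: poly_gbinomial_def)
qed

theorem mainTheorem5:
  fixes n m :: nat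
  assumes "int n \<ge> int m - 1"
  shows "assoc_hermite (indet_c :: 'k::field_char_0 poly) (int n) * hermite (int m) =
    (\<Sum>k = 0..min m ((n + m) div 2).
       smult (poly_gbinomial (of_nat n - 1 + indet_c) k * of_nat (m choose k) * fact k)
         (assoc_hermite indet_c (int n + int m - 2 * int k)))"
proof -
  have coeff: "poly_gbinomial a k * of_nat (m choose k) * fact k =
      (\<Prod>i<k. a - of_nat i) * of_nat (m choose k)" for a :: "'k poly" and k
    by (simp only: poly_gbinomial_mult_fact[symmetric] mult_ac)
  have "m \<le> n + 1" using assms by linarith
  \<comment> \<open>The terms cut off by the \<open>min\<close> have \<open>2 * k > n + m\<close>,
    hence a negative index.\<close>
  then show ?thesis
    unfolding coeff
    by (subst assoc_hermite_mult_hermite)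
      (auto intro!: sum.mono_neutral_right simp: assoc_hermite_neg)
qed

end
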